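(* Let $\mathcal{I}_2=\{X\in\operatorname{End}(\mathbb{R}^6)\mid X|_{W_2}=0\}$ (a left ideal of $\operatorname{End}(\mathbb{R}^6)$) and let $\pi:\operatorname{End}(\mathbb{R}^6)\to\operatorname{End}(\mathbb{R}^6)/\mathcal{I}_2$ be the natural projection as a vector space. Then, taking the closure in $\operatorname{End}(\mathbb{R}^6)/\mathcal{I}_2$, $$\bigcup_{n\in\mathbb{Z}}\overline{\pi\big(\check\rho^{-n}(\Sigma_{o_2}\cup\Sigma_{o_1}\cup\Sigma_{o_3})\check\rho^{n}\big)}=\mathbb{R}_{>0}\,\bar c_1+\mathbb{R}_{>0}\,\bar c_2,$$ where $\bar c_1=-\bar N_1+(2+\sqrt3)\bar N_2$ and $\bar c_2=\bar N_1-(2-\sqrt3)\bar N_2$ with $\bar N_i=\pi(N_i)$, $i=1,2$.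
   Context: The space $H^3(X^*_{b_o},\mathbb{R})$, for $X^*_{b_o}$ a fiber of the mirror family of a general complete intersection Calabi–Yau threefold of five $(1,1)$ divisors in $\mathbb{P}^4\times\mathbb{P}^4$, is identified with $\mathbb{R}^6$ (column vectors) through an ordered basis $\alpha_0,\alpha_1,\alpha_2,\beta_2,\beta_1,\beta_0$, endomorphisms with $6\times6$ matrices acting on column vectors, and $W_2=\langle\alpha_0,\alpha_1,\alpha_2\rangle$. $$\mathsf{T}_x=\begin{pmatrix}1&0&0&0&0&0\\1&1&0&0&0&0\\0&0&1&0&0&0\\5&10&10&1&0&0\\2&5&10&0&1&0\\-5&-3&-5&0&-1&1\end{pmatrix},\quad \mathsf{T}_y=\begin{pmatrix}1&0&0&0&0&0\\0&1&0&0&0&0\\1&0&1&0&0&0\\2&10&5&1&0&0\\5&10&10&0&1&0\\-5&-5&-3&-1&0&1\end{pmatrix}.$$ Put $N_1=-{}^t(\log\mathsf{T}_x)$, $N_2=-{}^t(\log\mathsf{T}_y)$ (logarithms of unipotent matrices). $$\check\varphi_{21}=\begin{pmatrix}-1&0&0&0&0&0\\0&1&-4&2&25&0\\0&0&-1&0&-2&0\\0&0&0&-1&-4&0\\0&0&0&0&1&0\\0&0&0&0&0&-1\end{pmatrix},\quad \check\varphi_{32}=\begin{pmatrix}-1&0&0&0&0&0\\0&-4&1&25&2&0\\0&-1&0&-2&0&0\\0&0&0&-4&-1&0\\0&0&0&1&0&0\\0&0&0&0&0&-1\end{pmatrix},$$ $$\check\varphi_{13}=\begin{pmatrix}-1&0&0&0&0&0\\0&-1&0&-2&0&0\\0&-4&1&-25&2&0\\0&0&0&1&0&0\\0&0&0&-4&-1&0\\0&0&0&0&0&-1\end{pmatrix},$$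 $\check\varphi_{31}=\check\varphi_{13}^{-1}$, $\check\rho=\check\varphi_{13}\check\varphi_{32}\check\varphi_{21}$. For $i=1,2$ put $N_i'=\check\varphi_{21}^{-1}N_i\check\varphi_{21}$, $N_i''=\check\varphi_{31}^{-1}N_i\check\varphi_{31}$. The monodromy nilpotent cones are $\Sigma_{o_1}=\mathbb{R}_{>0}N_1+\mathbb{R}_{>0}N_2$, $\Sigma_{o_2}=\mathbb{R}_{>0}N_1'+\mathbb{R}_{>0}N_2'$, $\Sigma_{o_3}=\mathbb{R}_{>0}N_1''+\mathbb{R}_{>0}N_2''$ in $\operatorname{End}(\mathbb{R}^6)$.
   Formalization: The right-hand side is the open cone together with the apex 0, since every closure on the left contains 0 while the open cone on the independent vectors c̄₁, c̄₂ does not. *)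

theory Defs
  imports "HOL-Analysis.Analysis"
begin

section \<open>Matrix powers and logarithms\<close>

text \<open>
  An endomorphism of \<open>\<real>\<^sup>6\<close> is a matrix of type \<open>real^6^6\<close> acting by \<open>*v\<close> on column vectors.
  The product is \<open>**\<close>; the class operations \<open>*\<close> and \<open>^\<close> on \<open>real^6^6\<close> act entrywise and
  are not used.
\<close>

definition mat_pow :: "real^'n^'n \<Rightarrow> nat \<Rightarrow> real^'n^'n"
  where "mat_pow A k = (((**) A) ^^ k) (mat 1)"

definition mat_powi :: "real^'n^'n \<Rightarrow> int \<Rightarrow> real^'n^'n"
  where "mat_powi A n =
    (if n \<ge> 0 then mat_pow A (nat n) else mat_pow (matrix_inv A) (nat (- n)))"

text \<open>
  For unipotent \<open>A\<close> of size \<open>d\<close> we have \<open>(A - 1)^d = 0\<close>, so the series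
  \<open>log A = (A - 1) - (A - 1)^2 / 2 + (A - 1)^3 / 3 - \<dots>\<close> stops before the \<open>d\<close>-th power.
\<close>

definition log_unipotent :: "real^'n^'n \<Rightarrow> real^'n^'n"
  where "log_unipotent A =
    (\<Sum>k = 1..<CARD('n). ((- 1) ^ (k + 1) / real k) *\<^sub>R mat_pow (A - mat 1) k)"


section \<open>Monodromy and gluing matrices\<close>

text \<open>
  Coordinates are taken in the order
  \<open>\<alpha>\<^sub>0, \<alpha>\<^sub>1, \<alpha>\<^sub>2, \<beta>\<^sub>2, \<beta>\<^sub>1, \<beta>\<^sub>0\<close>; these are the standard basis
  vectors with indices 1 to 6, where 6 = 0 in the index type.  The inner lists below are the matrix rows.
\<close>

definition Tx :: "real^6^6" where
  "Tx = vector
    [vector [ 1,  0,  0, 0,  0, 0],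
     vector [ 1,  1,  0, 0,  0, 0],
     vector [ 0,  0,  1, 0,  0, 0],
     vector [ 5, 10, 10, 1,  0, 0],
     vector [ 2,  5, 10, 0,  1, 0],
     vector [-5, -3, -5, 0, -1, 1]]"

definition Ty :: "real^6^6" where
  "Ty = vector
    [vector [ 1,  0,  0,  0, 0, 0],
     vector [ 0,  1,  0,  0, 0, 0],
     vector [ 1,  0,  1,  0, 0, 0],
     vector [ 2, 10,  5,  1, 0, 0],
     vector [ 5, 10, 10,  0, 1, 0],
     vector [-5, -5, -3, -1, 0, 1]]"

definition phi21 :: "real^6^6" where
  "phi21 = vector
    [vector [-1, 0,  0,  0,  0,  0],
     vector [ 0, 1, -4,  2, 25,  0],
     vector [ 0, 0, -1,  0, -2,  0],
     vector [ 0, 0,  0, -1, -4,  0],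
     vector [ 0, 0,  0,  0,  1,  0],
     vector [ 0, 0,  0,  0,  0, -1]]"

definition phi32 :: "real^6^6" where
  "phi32 = vector
    [vector [-1,  0, 0,  0,  0,  0],
     vector [ 0, -4, 1, 25,  2,  0],
     vector [ 0, -1, 0, -2,  0,  0],
     vector [ 0,  0, 0, -4, -1,  0],
     vector [ 0,  0, 0,  1,  0,  0],
     vector [ 0,  0, 0,  0,  0, -1]]"

definition phi13 :: "real^6^6" where
  "phi13 = vector
    [vector [-1,  0, 0,   0,  0,  0],
     vector [ 0, -1, 0,  -2,  0,  0],
     vector [ 0, -4, 1, -25,  2,  0],
     vector [ 0,  0, 0,   1,  0,  0],
     vector [ 0,  0, 0,  -4, -1,  0],
     vector [ 0,  0, 0,   0,  0, -1]]"

definition phi31 :: "real^6^6" where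
  "phi31 = matrix_inv phi13"

definition rho :: "real^6^6" where
  "rho = phi13 ** phi32 ** phi21"


section \<open>Monodromy nilpotent cones\<close>

definition N1 :: "real^6^6" where "N1 = - transpose (log_unipotent Tx)"
definition N2 :: "real^6^6" where "N2 = - transpose (log_unipotent Ty)"

definition N1' :: "real^6^6" where "N1' = matrix_inv phi21 ** N1 ** phi21"
definition N2' :: "real^6^6" where "N2' = matrix_inv phi21 ** N2 ** phi21"

definition N1'' :: "real^6^6" where "N1'' = matrix_inv phi31 ** N1 ** phi31"
definition N2'' :: "real^6^6" where "N2'' = matrix_inv phi31 ** N2 ** phi31"

definition pos_cone :: "'a::real_vector \<Rightarrow> 'a \<Rightarrow> 'a set"
  where "pos_cone u v = {a *\<^sub>R u + b *\<^sub>R v | a b. 0 < a \<and> 0 < b}"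

definition Sigma1 :: "(real^6^6) set" where "Sigma1 = pos_cone N1 N2"
definition Sigma2 :: "(real^6^6) set" where "Sigma2 = pos_cone N1' N2'"
definition Sigma3 :: "(real^6^6) set" where "Sigma3 = pos_cone N1'' N2''"


section \<open>The quotient by the left ideal of endomorphisms vanishing on \<open>W\<^sub>2\<close>\<close>

definition W2 :: "(real^6) set"
  where "W2 = span {axis 1 1, axis 2 1, axis 3 1}"

definition I2 :: "(real^6^6) set"
  where "I2 = {X. \<forall>w\<in>W2. X *v w = 0}"

lemma subspace_I2: "subspace I2"
  by (auto simp: I2_def subspace_def matrix_vector_mult_add_rdistrib scaleR_matrix_vector_assoc[symmetric])

lemma I2_left_ideal: "X \<in> I2 \<Longrightarrow> A ** X \<in> I2"
  by (simp add: I2_def matrix_vector_mul_assoc[symmetric])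

definition I2_rel :: "real^6^6 \<Rightarrow> real^6^6 \<Rightarrow> bool"
  where "I2_rel X Y \<longleftrightarrow> X - Y \<in> I2"

lemma equivp_I2_rel: "equivp I2_rel"
proof (rule equivpI)
  show "reflp I2_rel"
    using subspace_0[OF subspace_I2] by (simp add: reflp_def I2_rel_def)
  show "symp I2_rel"
    using subspace_neg[OF subspace_I2] by (force simp: symp_def I2_rel_def)
  show "transp I2_rel"
    using subspace_add[OF subspace_I2] by (force simp: transp_def I2_rel_def)
qed

quotient_type End_mod_I2 = "real^6^6" / I2_rel
  by (rule equivp_I2_rel)

lift_definition proj :: "real^6^6 \<Rightarrow> End_mod_I2" is "\<lambda>X. X" .

instantiation End_mod_I2 :: real_vector
begin

lift_definition zero_End_mod_I2 :: End_mod_I2 is "0" .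

lift_definition plus_End_mod_I2 :: "End_mod_I2 \<Rightarrow> End_mod_I2 \<Rightarrow> End_mod_I2" is "(+)"
  using subspace_add[OF subspace_I2] by (force simp: I2_rel_def algebra_simps)

lift_definition uminus_End_mod_I2 :: "End_mod_I2 \<Rightarrow> End_mod_I2" is "uminus"
  using subspace_neg[OF subspace_I2] by (force simp: I2_rel_def)

lift_definition minus_End_mod_I2 :: "End_mod_I2 \<Rightarrow> End_mod_I2 \<Rightarrow> End_mod_I2" is "(-)"
  using subspace_diff[OF subspace_I2] by (force simp: I2_rel_def algebra_simps)

lift_definition scaleR_End_mod_I2 :: "real \<Rightarrow> End_mod_I2 \<Rightarrow> End_mod_I2" is "(*\<^sub>R)"
  using subspace_scale[OF subspace_I2]
  by (auto simp: I2_rel_def scaleR_diff_right[symmetric])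

instance
  by standard
    (transfer; use subspace_0[OF subspace_I2] in \<open>simp add: I2_rel_def algebra_simps\<close>)+

end

lemma linear_proj: "linear proj"
  by (rule linearI; transfer; simp add: I2_rel_def subspace_0[OF subspace_I2])

lemma surj_proj: "surj proj"
proof -
  have "\<exists>X. q = proj X" for q
    by (transfer, metis equivp_I2_rel equivp_reflp)
  then show ?thesis by (simp add: surj_def)
qed

lemma proj_eq_iff: "proj X = proj Y \<longleftrightarrow> X - Y \<in> I2"
  by transfer (simp add: I2_rel_def)

text \<open>
  The quotient carries the quotient topology, which is the usual topology of this
  finite-dimensional real vector space.
\<close>

instantiation End_mod_I2 :: topological_space
begin

definition open_End_mod_I2 :: "End_mod_I2 set \<Rightarrow> bool"
  where "open_End_mod_I2 U \<longleftrightarrow> open (proj -` U)"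

instance
  by standard (auto simp: open_End_mod_I2_def vimage_Union intro: open_Int)

end

end

theory Submission
  imports Defs
begin

text \<open>
  The gluing matrices and the nilpotents preserve \<open>W\<^sub>2\<close> and send the first basis vector \<open>e\<^sub>1\<close> to a multiple of
  itself, while \<open>N\<^sub>1\<close> and \<open>N\<^sub>2\<close>, restricted to \<open>W\<^sub>2\<close>, map \<open>e\<^sub>2\<close> and \<open>e\<^sub>3\<close> respectively to
  \<open>-e\<^sub>1\<close> and kill the other basis vectors.  Modulo \<open>I2\<close> an endomorphism is its restriction to
  \<open>W\<^sub>2\<close>, so every cone in question lands in the plane spanned by the classes of \<open>N\<^sub>1\<close> and
  \<open>N\<^sub>2\<close>, and conjugation by a gluing matrix acts there through the \<open>2 \<times> 2\<close> block that the
  matrix has on \<open>e\<^sub>2, e\<^sub>3\<close> (\<open>proj_conjugate\<close>).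

  In this plane let \<open>ray k\<close> be the vector with coordinates \<open>(-u\<^sub>k, u\<^bsub>k+1\<^esub>)\<close>, where
  \<open>u\<^bsub>k+2\<^esub> = 4 u\<^bsub>k+1\<^esub> - u\<^sub>k\<close>, \<open>u\<^sub>0 = 0\<close>, \<open>u\<^sub>1 = 1\<close>.  The cones
  \<open>Sigma2\<close>, \<open>Sigma1\<close>, \<open>Sigma3\<close> project to the open sectors between the consecutive rays number
  \<open>1, 0, -1, -2\<close>, and conjugation by \<open>rho\<close> moves \<open>ray k\<close> to \<open>ray (k + 3)\<close>
  (\<open>proj_conjugate_rho_powi\<close>).  Thus the conjugates of the three closed sectors are exactly the
  closed sectors between \<open>ray k\<close> and \<open>ray (k + 1)\<close> for all integers \<open>k\<close>.

  The roots of \<open>x\<^sup>2 - 4 x + 1\<close> are \<open>2 + sqrt 3\<close> and its inverse \<open>2 - sqrt 3\<close>, so in terms of the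
  two generators \<open>c\<^sub>1, c\<^sub>2\<close> of the limit cone, eigenvectors of \<open>rho\<close>, the ray number \<open>k\<close> is, up to a fixed positive factor,
  \<open>(2 + sqrt 3)\<^sup>k c\<^sub>1 + (2 + sqrt 3)\<^sup>-\<^sup>k c\<^sub>2\<close>.  The ratio of the two coordinates runs
  through a doubly infinite geometric progression; the closed sectors therefore cover all positive
  ratios and nothing else, which is the open cone on \<open>c\<^sub>1, c\<^sub>2\<close>, together with the apex \<open>0\<close>
  that lies in every closed sector (\<open>union_nonneg_cones\<close>).

  The closure is taken in the whole quotient; it may be computed in the plane because the inclusion
  of \<open>\<real>\<^sup>2\<close> is continuous and closed (\<open>closure_N_plane_image\<close>).
\<close>

section \<open>Coordinates in dimension six\<close>

lemma exhaust_6: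
  fixes x :: 6
  shows "x = 1 \<or> x = 2 \<or> x = 3 \<or> x = 4 \<or> x = 5 \<or> x = 6"
proof (induct x)
  case (of_int z)
  then have "0 \<le> z" and "z < 6" by simp_all
  then have "z = 0 \<or> z = 1 \<or> z = 2 \<or> z = 3 \<or> z = 4 \<or> z = 5" by arith
  then show ?case by auto
qed

lemma forall_6: "(\<forall>i::6. P i) \<longleftrightarrow> P 1 \<and> P 2 \<and> P 3 \<and> P 4 \<and> P 5 \<and> P 6"
  by (metis exhaust_6)

lemma sum_6: "sum f (UNIV::6 set) = f 1 + f 2 + f 3 + f 4 + f 5 + f 6"
proof -
  have UNIV_6: "UNIV = {1::6, 2, 3, 4, 5, 6}" using exhaust_6 by auto
  show ?thesis unfolding UNIV_6 by (simp add: ac_simps)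
qed

lemma vector_6:
  "(vector [a,b,c,d,e,f] ::('a::zero)^6)$1 = a"
  "(vector [a,b,c,d,e,f] ::('a::zero)^6)$2 = b"
  "(vector [a,b,c,d,e,f] ::('a::zero)^6)$3 = c"
  "(vector [a,b,c,d,e,f] ::('a::zero)^6)$4 = d"
  "(vector [a,b,c,d,e,f] ::('a::zero)^6)$5 = e"
  "(vector [a,b,c,d,e,f] ::('a::zero)^6)$6 = f"
  unfolding vector_def by simp_all

lemma matrix_vector_mult_6:
  fixes A :: "real^6^6"
  shows "(A *v x) $ i = A$i$1 * x$1 + A$i$2 * x$2 + A$i$3 * x$3 + A$i$4 * x$4 + A$i$5 * x$5 + A$i$6 * x$6"
  by (simp add: matrix_vector_mult_def sum_6)

lemmas coordinates_6 = vec_eq_iff forall_6 matrix_vector_mult_6 vector_6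

abbreviation e :: "6 \<Rightarrow> real^6" where "e i \<equiv> axis i 1"

lemma phi21_basis: "phi21 *v e 1 = - e 1" "phi21 *v e 2 = e 2" "phi21 *v e 3 = - 4 *\<^sub>R e 2 - e 3"
  by (simp_all add: coordinates_6 phi21_def axis_def)

lemma phi32_basis: "phi32 *v e 1 = - e 1" "phi32 *v e 2 = - 4 *\<^sub>R e 2 - e 3" "phi32 *v e 3 = e 2"
  by (simp_all add: coordinates_6 phi32_def axis_def)

lemma phi13_basis: "phi13 *v e 1 = - e 1" "phi13 *v e 2 = - e 2 - 4 *\<^sub>R e 3" "phi13 *v e 3 = e 3"
  by (simp_all add: coordinates_6 phi13_def axis_def)

lemma invertible_phi: "invertible phi21" "invertible phi32" "invertible phi13"
  unfolding invertible_left_inverse matrix_left_invertible_ker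
  by (auto simp: coordinates_6 phi21_def phi32_def phi13_def)

section \<open>Logarithms of unipotent matrices\<close>

lemma mat_pow_Suc: "mat_pow A (Suc k) = A ** mat_pow A k"
  by (simp add: mat_pow_def)

lemma vector_mat_pow_Suc: "x v* mat_pow A (Suc k) = (x v* A) v* mat_pow A k"
  by (simp add: mat_pow_Suc vector_matrix_mul_assoc)

text \<open>
  Applied to a row vector that is killed by the square of \<open>A - 1\<close>, the logarithm series stops after
  its linear term. The first three unit row vectors are of this kind for \<open>Tx\<close> and \<open>Ty\<close>, which gives
  the restrictions of \<open>N1\<close> and \<open>N2\<close> to \<open>W2\<close> without computing the full logarithms.
\<close>

lemma vector_log_unipotent:
  fixes A :: "real^'n^'n"
  assumes sq: "(x v* (A - mat 1)) v* (A - mat 1) = 0"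
    and dim: "1 < CARD('n)"
  shows "x v* log_unipotent A = x v* (A - mat 1)"
proof -
  let ?B = "A - mat 1"
  have sum_right: "x v* sum F S = (\<Sum>k\<in>S. x v* F k)" for F :: "nat \<Rightarrow> real^'n^'n" and S
    by (induction S rule: infinite_finite_induct)
       (simp_all add: vector_matrix_mult_def vec_eq_iff sum.distrib algebra_simps)
  have scale_right: "x v* (c *\<^sub>R M) = c *\<^sub>R (x v* M)" for c and M :: "real^'n^'n"
    by (simp add: vector_matrix_mult_def vec_eq_iff sum_distrib_left mult.left_commute)
  have pow: "x v* mat_pow ?B k = (if k = 1 then x v* ?B else 0)" if k: "1 \<le> k" for k
  proof (cases "k = 1")
    case True
    then show ?thesis by (simp add: mat_pow_def)
  next
    case False
    with k obtain j where "k = Suc (Suc j)"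
      by (metis One_nat_def not0_implies_Suc not_one_le_zero)
    then show ?thesis
      by (simp add: vector_mat_pow_Suc sq)
  qed
  have "x v* log_unipotent A
      = (\<Sum>k = 1..<CARD('n). ((- 1) ^ (k + 1) / real k) *\<^sub>R (x v* mat_pow ?B k))"
    by (simp only: log_unipotent_def sum_right scale_right)
  also have "\<dots> = (\<Sum>k = 1..<CARD('n). if k = 1 then x v* ?B else 0)"
    by (intro sum.cong) (auto simp: pow)
  also have "\<dots> = x v* ?B"
    using dim by (simp add: sum.delta)
  finally show ?thesis .
qed

section \<open>The plane spanned by the classes of the two nilpotents\<close>

lemma uminus_matrix_vector: "(- A) *v x = - (A *v (x :: real^'n))" for A :: "real^'n^'m"
  by (simp add: vec_eq_iff matrix_vector_mult_def sum_negf)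

lemma matrix_vector_uminus: "A *v (- x) = - (A *v (x :: real^'n))" for A :: "real^'n^'m"
  by (simp add: vec_eq_iff matrix_vector_mult_def sum_negf)

lemma N1_basis: "N1 *v e 1 = 0" "N1 *v e 2 = - e 1" "N1 *v e 3 = 0"
proof -
  have B: "e 1 v* (Tx - mat 1) = 0" "e 2 v* (Tx - mat 1) = e 1"
     "e 3 v* (Tx - mat 1) = 0"
    by (simp_all add: coordinates_6 vector_matrix_mult_def sum_6 Tx_def mat_def axis_def)
  show "N1 *v e 1 = 0" "N1 *v e 2 = - e 1" "N1 *v e 3 = 0"
    by (simp_all add: N1_def uminus_matrix_vector vector_log_unipotent B)
qed

lemma N2_basis: "N2 *v e 1 = 0" "N2 *v e 2 = 0" "N2 *v e 3 = - e 1"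
proof -
  have B: "e 1 v* (Ty - mat 1) = 0" "e 2 v* (Ty - mat 1) = 0"
     "e 3 v* (Ty - mat 1) = e 1"
    by (simp_all add: coordinates_6 vector_matrix_mult_def sum_6 Ty_def mat_def axis_def)
  show "N2 *v e 1 = 0" "N2 *v e 2 = 0" "N2 *v e 3 = - e 1"
    by (simp_all add: N2_def uminus_matrix_vector vector_log_unipotent B)
qed

lemma proj_eq_iff_basis:
  "proj X = proj Y \<longleftrightarrow> X *v e 1 = Y *v e 1 \<and> X *v e 2 = Y *v e 2 \<and> X *v e 3 = Y *v e 3"
proof -
  let ?K = "{w. (X - Y) *v w = 0}"
  have "subspace ?K"
    by (auto simp: subspace_def matrix_vector_right_distrib matrix_vector_mult_scaleR)
  then have "W2 \<subseteq> ?K \<longleftrightarrow> {e 1, e 2, e 3} \<subseteq> ?K"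
    unfolding W2_def using span_minimal span_superset by (meson order_trans)
  moreover have "X - Y \<in> I2 \<longleftrightarrow> W2 \<subseteq> ?K"
    by (auto simp: I2_def)
  ultimately have "X - Y \<in> I2 \<longleftrightarrow> (\<forall>w\<in>{e 1, e 2, e 3}. (X - Y) *v w = 0)"
    by auto
  then show ?thesis
    by (simp add: proj_eq_iff matrix_vector_mult_diff_rdistrib)
qed

lemma proj_eq_N_combination_iff:
  "proj X = a *\<^sub>R proj N1 + b *\<^sub>R proj N2
    \<longleftrightarrow> X *v e 1 = 0 \<and> X *v e 2 = - a *\<^sub>R e 1 \<and> X *v e 3 = - b *\<^sub>R e 1"
proof -
  have "a *\<^sub>R proj N1 + b *\<^sub>R proj N2 = proj (a *\<^sub>R N1 + b *\<^sub>R N2)"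
    by (simp add: linear_add[OF linear_proj] linear_cmul[OF linear_proj])
  then show ?thesis
    by (simp add: proj_eq_iff_basis matrix_vector_mult_add_rdistrib N1_basis N2_basis
        scaleR_matrix_vector_assoc[symmetric])
qed

text \<open>
  With \<open>X\<close> acting on \<open>W2\<close> by \<open>e 2 \<mapsto> - a e 1\<close> and \<open>e 3 \<mapsto> - b e 1\<close>, the conjugate has as
  coordinates the row vector \<open>(a, b)\<close> times the block \<open>(p, r; q, s)\<close> of \<open>g\<close>, negated because
  \<open>h\<close> sends \<open>e 1\<close> to \<open>- e 1\<close>.
\<close>

lemma proj_conjugate:
  assumes X: "proj X = a *\<^sub>R proj N1 + b *\<^sub>R proj N2"
    and hg: "h ** g = mat 1"
    and g: "g *v e 1 = - e 1" "g *v e 2 = p *\<^sub>R e 2 + q *\<^sub>R e 3" "g *v e 3 = r *\<^sub>R e 2 + s *\<^sub>R e 3"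
  shows "proj (h ** X ** g) = - (p * a + q * b) *\<^sub>R proj N1 - (r * a + s * b) *\<^sub>R proj N2"
proof -
  have "h *v (g *v e 1) = e 1"
    by (simp add: matrix_vector_mul_assoc hg)
  then have h: "h *v e 1 = - e 1"
    by (metis g(1) matrix_vector_uminus minus_minus)
  have "proj (h ** X ** g) = (- (p * a + q * b)) *\<^sub>R proj N1 + (- (r * a + s * b)) *\<^sub>R proj N2"
    using X unfolding proj_eq_N_combination_iff
    by (simp add: g h matrix_vector_mul_assoc[symmetric] matrix_vector_right_distrib
        matrix_vector_uminus matrix_vector_mult_scaleR scaleR_add_left)
  then show ?thesis by (simp only: scaleR_minus_left add_uminus_conv_diff)
qed

section \<open>Closures in the quotient\<close>

definition N_plane :: "real \<times> real \<Rightarrow> End_mod_I2"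
  where "N_plane p = fst p *\<^sub>R proj N1 + snd p *\<^sub>R proj N2"

lemma linear_N_plane: "linear N_plane"
  by (rule linearI) (simp_all add: N_plane_def algebra_simps)

lemma continuous_N_plane: "continuous_on UNIV N_plane"
proof -
  have proj: "continuous_on UNIV proj"
    by (auto simp: continuous_on_open_vimage open_End_mod_I2_def)
  have lift: "continuous_on UNIV (\<lambda>p::real \<times> real. fst p *\<^sub>R N1 + snd p *\<^sub>R N2)"
    by (intro continuous_intros)
  have eq: "N_plane = proj \<circ> (\<lambda>p. fst p *\<^sub>R N1 + snd p *\<^sub>R N2)"
    by (auto simp: N_plane_def linear_add[OF linear_proj] linear_cmul[OF linear_proj])
  show ?thesis
    unfolding eq by (rule continuous_on_compose[OF lift continuous_on_subset[OF proj subset_UNIV]])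
qed

text \<open>
  On the plane the coordinates can be read off as two matrix entries. The preimage of \<open>N_plane ` C\<close>
  is then cut out by the linear condition that \<open>X\<close> is congruent to the point with these coordinates
  and by the closed condition that the coordinates lie in \<open>C\<close>.
\<close>

lemma closed_N_plane_image:
  assumes "closed C"
  shows "closed (N_plane ` C)"
proof -
  define c where "c X = (- X$1$2, - X$1$3)" for X :: "real^6^6"
  define K where "K = {X. proj X = N_plane (c X)}"
  have entries: "a = - X$1$2 \<and> b = - X$1$3"
    if "proj X = a *\<^sub>R proj N1 + b *\<^sub>R proj N2" for X a b
  proof -
    have "(X *v e 2)$1 = - a" "(X *v e 3)$1 = - b"
      using that by (simp_all add: proj_eq_N_combination_iff)
    then show ?thesis by (simp add: matrix_vector_mult_basis column_def)
  qed
  have "proj -` (N_plane ` C) = K \<inter> c -` C"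
  proof (intro equalityI subsetI)
    fix X assume "X \<in> proj -` (N_plane ` C)"
    then obtain p where p: "p \<in> C" "proj X = N_plane p" by blast
    then have "c X = p"
      using entries[of X "fst p" "snd p"] by (simp add: N_plane_def c_def prod_eq_iff)
    with p show "X \<in> K \<inter> c -` C" by (simp add: K_def)
  next
    fix X assume "X \<in> K \<inter> c -` C"
    then show "X \<in> proj -` (N_plane ` C)" by (simp add: K_def)
  qed
  moreover have "closed (c -` C)"
    using assms unfolding c_def by (intro closed_vimage continuous_intros)
  moreover have "closed K"
  proof (rule closed_subspace)
    have "linear c"
      by (rule linearI) (simp_all add: c_def)
    then show "subspace K"
      unfolding K_def subspace_def
      by (simp add: linear_0 linear_add linear_cmul linear_proj linear_N_plane)
  qed
  ultimately have "closed (proj -` (N_plane ` C))" by auto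
  then show ?thesis
    by (simp add: closed_def open_End_mod_I2_def vimage_Compl)
qed

lemma closure_N_plane_image: "closure (N_plane ` S) = N_plane ` closure S"
proof
  show "closure (N_plane ` S) \<subseteq> N_plane ` closure S"
    by (intro closure_minimal image_mono closure_subset closed_N_plane_image closed_closure)
  show "N_plane ` closure S \<subseteq> closure (N_plane ` S)"
    by (intro image_closure_subset closure_subset closed_closure
        continuous_on_subset[OF continuous_N_plane]) auto
qed

section \<open>Closed sectors\<close>

definition nonneg_cone :: "'a::real_vector \<Rightarrow> 'a \<Rightarrow> 'a set"
  where "nonneg_cone u v = {a *\<^sub>R u + b *\<^sub>R v | a b. 0 \<le> a \<and> 0 \<le> b}"

lemma pos_cone_eq_image:
  "pos_cone u v = (\<lambda>p. fst p *\<^sub>R u + snd p *\<^sub>R v) ` ({0<..} \<times> {0<..})"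
  by (simp add: pos_cone_def set_eq_iff image_iff Bex_def split_paired_Ex) blast

lemma nonneg_cone_eq_image:
  "nonneg_cone u v = (\<lambda>p. fst p *\<^sub>R u + snd p *\<^sub>R v) ` ({0..} \<times> {0..})"
  by (simp add: nonneg_cone_def set_eq_iff image_iff Bex_def split_paired_Ex) blast

lemma pos_cone_image: "linear f \<Longrightarrow> f ` pos_cone u v = pos_cone (f u) (f v)"
  by (simp add: pos_cone_eq_image image_image linear_add linear_cmul)

lemma nonneg_cone_image: "linear f \<Longrightarrow> f ` nonneg_cone u v = nonneg_cone (f u) (f v)"
  by (simp add: nonneg_cone_eq_image image_image linear_add linear_cmul)

lemma pos_cone_commute: "pos_cone u v = pos_cone v u"
proof -
  have "pos_cone u v \<subseteq> pos_cone v u" for u v :: 'a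
    unfolding pos_cone_def by clarsimp (metis add.commute)
  then show ?thesis by blast
qed

text \<open>
  Independent generators identify the open cone linearly with the open quadrant, whose closure is the
  closed quadrant.
\<close>

lemma closure_pos_cone_plane:
  fixes u v :: "real \<times> real"
  assumes "fst u * snd v \<noteq> fst v * snd u"
  shows "closure (pos_cone u v) = nonneg_cone u v"
proof -
  define f where "f p = fst p *\<^sub>R u + snd p *\<^sub>R v" for p :: "real \<times> real"
  have lin: "linear f"
    by (rule linearI) (simp_all add: f_def algebra_simps)
  have "inj f"
    unfolding linear_injective_0[OF lin]
  proof (intro allI impI)
    fix p assume "f p = 0"
    then have eq: "fst p * fst u + snd p * fst v = 0" "fst p * snd u + snd p * snd v = 0"
      by (simp_all add: f_def prod_eq_iff)
    have "fst p * (fst u * snd v - fst v * snd u) = 0" "snd p * (fst u * snd v - fst v * snd u) = 0"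
      using eq by algebra+
    with assms show "p = 0" by (simp add: prod_eq_iff)
  qed
  then have "closure (f ` ({0<..} \<times> {0<..})) = f ` ({0..} \<times> {0..})"
    using lin by (simp add: closure_injective_linear_image[symmetric] closure_Times)
  moreover have "f ` ({0<..} \<times> {0<..}) = pos_cone u v" "f ` ({0..} \<times> {0..}) = nonneg_cone u v"
    by (simp_all add: f_def pos_cone_eq_image nonneg_cone_eq_image)
  ultimately show ?thesis by simp
qed

text \<open>
  In terms of the coefficients of \<open>s v + t w\<close>, the sector number \<open>k\<close> consists of the apex and of
  the positive pairs \<open>(s, t)\<close> with \<open>l ^ (2 k) \<le> s / t \<le> l ^ (2 k + 2)\<close>. As \<open>l > 1\<close>, these intervals
  cover the positive half line.
\<close>

lemma union_nonneg_cones: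
  fixes v w :: "'a::real_vector" and l :: real
  assumes l: "1 < l"
  defines "r \<equiv> \<lambda>k::int. (l powi k) *\<^sub>R v + (l powi (- k)) *\<^sub>R w"
  shows "(\<Union>k. nonneg_cone (r k) (r (k + 1))) = insert 0 (pos_cone v w)"
proof (intro equalityI subsetI)
  have comb: "a *\<^sub>R r k + b *\<^sub>R r (k + 1)
      = (a * l powi k + b * l powi (k + 1)) *\<^sub>R v + (a * l powi (- k) + b * l powi (- (k + 1))) *\<^sub>R w"
    for a b k by (simp add: r_def algebra_simps)
  have pos: "0 < l powi k" for k using l by simp
  {
    fix x assume "x \<in> (\<Union>k. nonneg_cone (r k) (r (k + 1)))"
    then obtain k a b where x: "x = a *\<^sub>R r k + b *\<^sub>R r (k + 1)" and ab: "0 \<le> a" "0 \<le> b"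
      by (auto simp: nonneg_cone_def)
    show "x \<in> insert 0 (pos_cone v w)"
    proof (cases "a = 0 \<and> b = 0")
      case True
      then show ?thesis by (simp add: x)
    next
      case False
      have "0 < a * l powi i + b * l powi j" for i j
        using False ab pos[of i] pos[of j]
        by (metis add_nonneg_pos add_pos_nonneg less_eq_real_def mult_nonneg_nonneg mult_pos_pos)
      then show ?thesis unfolding x comb pos_cone_def by blast
    qed
  next
    fix x assume "x \<in> insert 0 (pos_cone v w)"
    then consider "x = 0" | s t where "x = s *\<^sub>R v + t *\<^sub>R w" "0 < s" "0 < t"
      by (auto simp: pos_cone_def)
    then show "x \<in> (\<Union>k. nonneg_cone (r k) (r (k + 1)))"
    proof cases
      case 1
      then have "x = 0 *\<^sub>R r 0 + 0 *\<^sub>R r (0 + 1)" by simp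
      then show ?thesis unfolding nonneg_cone_def by blast
    next
      case 2
      \<comment> \<open>The number of the sector is read off from the logarithm of \<open>sqrt (s / t)\<close>.\<close>
      define z where "z = sqrt (s / t)"
      have z: "0 < z" "z ^ 2 = s / t" using 2 by (simp_all add: z_def)
      define k where "k = \<lfloor>log l z\<rfloor>"
      define q where "q = l powi k"
      have q: "0 < q" using pos by (simp add: q_def)
      have "l powr k \<le> z" "z < l powr (k + 1)"
        using l z floor_log_eq_powr_iff[of z l k] by (simp_all add: k_def)
      then have "q \<le> z" "z < q * l"
        using l by (simp_all add: q_def powr_real_of_int' powr_add)
      then have "q ^ 2 \<le> s / t" "s / t \<le> (q * l) ^ 2"
        using q z by (simp_all flip: z(2) add: power_mono)
      then have S: "t * q \<le> s / q" "s / q \<le> t * q * l ^ 2"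
        using 2 q by (simp_all add: field_simps power2_eq_square)
      \<comment> \<open>Solution of \<open>a + b * l = s / q\<close> and \<open>a + b / l = t * q\<close>.\<close>
      define b where "b = (s / q - t * q) / (l - 1 / l)"
      define a where "a = (l * (t * q) - (s / q) / l) / (l - 1 / l)"
      have "0 < l - 1 / l" using l by (simp add: field_simps) (metis less_1_mult)
      moreover have "(s / q) / l \<le> l * (t * q)"
      proof -
        have "(s / q) / l \<le> (t * q * l ^ 2) / l"
          using S l by (intro divide_right_mono) auto
        then show ?thesis using l by (simp add: power2_eq_square mult_ac)
      qed
      ultimately have "0 \<le> a" "0 \<le> b" using S by (simp_all add: a_def b_def)
      have d: "l * l - 1 \<noteq> 0" using l by (metis diff_gt_0_iff_gt less_1_mult less_irrefl)
      have "a * q + b * (q * l) = s" "a * (1 / q) + b * (1 / (q * l)) = t"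
        using l q d by (simp_all add: a_def b_def divide_simps) (simp_all add: algebra_simps)
      then have "x = a *\<^sub>R r k + b *\<^sub>R r (k + 1)"
        unfolding comb 2(1) q_def using l
        by (simp add: power_int_add power_int_diff power_int_minus field_simps)
      with \<open>0 \<le> a\<close> \<open>0 \<le> b\<close> show ?thesis unfolding nonneg_cone_def by blast
    qed
  }
qed

lemma pos_cone_scaleR:
  assumes "0 < r"
  shows "pos_cone (r *\<^sub>R u) (r *\<^sub>R v) = pos_cone u v"
proof -
  have "pos_cone (r *\<^sub>R u) (r *\<^sub>R v) \<subseteq> pos_cone u v" if "0 < r" for r and u v :: 'a
    using that unfolding pos_cone_def by clarsimp (metis mult_pos_pos)
  from this[of r u v] this[of "1 / r" "r *\<^sub>R u" "r *\<^sub>R v"] show ?thesis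
    using assms by auto
qed

section \<open>The rays bounding the sectors\<close>

text \<open>
  Lucas sequence of the polynomial \<open>x\<^sup>2 - 4 x + 1\<close>, with values
  \<open>\<dots>, -4, -1, 0, 1, 4, 15, 56, \<dots>\<close>. The closed form makes all integer indices available and
  exhibits the eigenvalues.
\<close>

definition lucas :: "int \<Rightarrow> real"
  where "lucas k = ((2 + sqrt 3) powi k - (2 + sqrt 3) powi (- k)) / (2 * sqrt 3)"

lemma inverse_unit: "inverse (2 + sqrt 3) = 2 - sqrt 3"
  by (rule inverse_unique) (simp add: algebra_simps)

lemma unit_nonzero: "2 + sqrt 3 \<noteq> (0::real)"
  by (metis add_pos_pos less_irrefl real_sqrt_gt_zero zero_less_numeral)

lemma lucas_values: "lucas 0 = 0" "lucas 1 = 1"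
  using inverse_unit by (simp_all add: lucas_def power_int_minus)

lemma lucas_recurrence: "lucas (k + 2) = 4 * lucas (k + 1) - lucas k"
proof -
  have u: "(2 + sqrt 3) powi (k + 2) = 4 * (2 + sqrt 3) powi (k + 1) - (2 + sqrt 3) powi k"
    using unit_nonzero by (simp add: power_int_add algebra_simps power2_eq_square)
  have v: "(2 - sqrt 3) powi (k + 2) = 4 * (2 - sqrt 3) powi (k + 1) - (2 - sqrt 3) powi k"
    using unit_nonzero by (simp flip: inverse_unit add: power_int_add)
       (simp add: inverse_unit algebra_simps power2_eq_square)
  have m: "(2 + sqrt 3) powi (- j) = (2 - sqrt 3) powi j" for j
    by (simp add: power_int_minus power_int_inverse flip: inverse_unit)
  have "((4 * a' - a) - (4 * b' - b)) / d = 4 * ((a' - b') / d) - (a - b) / d" for a a' b b' d :: real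
    by (simp add: diff_divide_distrib)
  then show ?thesis unfolding lucas_def m u v .
qed

text \<open>
  Adjacent rays form a basis: the matrix of consecutive terms is multiplied by a matrix of determinant
  \<open>1\<close> at each step.
\<close>

lemma lucas_determinant: "lucas (k + 1) * lucas (k + 1) - lucas k * lucas (k + 2) = 1"
proof (induction k rule: int_induct[where k = 0])
  case base
  then show ?case by (simp add: lucas_values)
next
  case (step1 i)
  then show ?case
    using lucas_recurrence[of i] lucas_recurrence[of "i + 1"] by (simp add: add.assoc) algebra
next
  case (step2 i)
  have shift: "i - 1 + 1 = i" "i - 1 + 2 = i + 1" by simp_all
  show ?case
    using step2 lucas_recurrence[of "i - 1"] lucas_recurrence[of i] unfolding shift by algebra
qed

definition ray :: "int \<Rightarrow> End_mod_I2"
  where "ray k = - lucas k *\<^sub>R proj N1 + lucas (k + 1) *\<^sub>R proj N2"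


lemma ray_eq_N_plane: "ray k = N_plane (- lucas k, lucas (k + 1))"
  by (simp add: ray_def N_plane_def)

lemma closure_pos_cone_ray:
  "closure (pos_cone (ray k) (ray (k + 1))) = nonneg_cone (ray k) (ray (k + 1))"
proof -
  have "closure (pos_cone (- lucas k, lucas (k + 1)) (- lucas (k + 1), lucas (k + 2)))
      = nonneg_cone (- lucas k, lucas (k + 1)) (- lucas (k + 1), lucas (k + 2))"
    using lucas_determinant[of k] by (intro closure_pos_cone_plane) (auto simp: algebra_simps)
  then show ?thesis
    by (simp add: ray_eq_N_plane pos_cone_image[OF linear_N_plane, symmetric]
        nonneg_cone_image[OF linear_N_plane, symmetric] closure_N_plane_image add.assoc)
qed

text \<open>
  By the closed form of \<open>lucas\<close>, \<open>ray k\<close> is the combination of the two eigenvectors, scaled by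
  \<open>1 / (2 * sqrt 3)\<close>, with coefficients \<open>(2 + sqrt 3) powi k\<close> and \<open>(2 + sqrt 3) powi (- k)\<close>.
\<close>

lemma union_nonneg_cone_ray:
  "(\<Union>k. nonneg_cone (ray k) (ray (k + 1)))
     = insert 0 (pos_cone (- proj N1 + (2 + sqrt 3) *\<^sub>R proj N2)
                          (proj N1 - (2 - sqrt 3) *\<^sub>R proj N2))"
proof -
  let ?c1 = "- proj N1 + (2 + sqrt 3) *\<^sub>R proj N2"
  let ?c2 = "proj N1 - (2 - sqrt 3) *\<^sub>R proj N2"
  let ?d = "1 / (2 * sqrt 3)"
  have unit: "(2 + sqrt 3) powi (k + 1) = (2 + sqrt 3) powi k * (2 + sqrt 3)"
    "(2 + sqrt 3) powi (- (k + 1)) = (2 + sqrt 3) powi (- k) * (2 - sqrt 3)" for k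
    using unit_nonzero
    by (simp_all add: power_int_add power_int_diff inverse_unit[symmetric] divide_inverse)
  have regroup: "- ((p - q) / d) *\<^sub>R u + ((p * l - q * m) / d) *\<^sub>R v
      = p *\<^sub>R ((1 / d) *\<^sub>R (- u + l *\<^sub>R v)) + q *\<^sub>R ((1 / d) *\<^sub>R (u - m *\<^sub>R v))"
    for p q d l m :: real and u v :: End_mod_I2
    by (simp add: algebra_simps diff_divide_distrib)
  have "ray k = ((2 + sqrt 3) powi k) *\<^sub>R (?d *\<^sub>R ?c1) + ((2 + sqrt 3) powi (- k)) *\<^sub>R (?d *\<^sub>R ?c2)" for k
    unfolding ray_def lucas_def unit by (rule regroup)
  moreover have "1 < 2 + sqrt (3::real)"
    by (smt (verit) real_sqrt_ge_zero)
  ultimately show ?thesis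
    using union_nonneg_cones[of "2 + sqrt 3" "?d *\<^sub>R ?c1" "?d *\<^sub>R ?c2"] pos_cone_scaleR[of ?d ?c1 ?c2]
    by simp
qed

lemma proj_N1: "proj N1 = ray (- 1)" and proj_N2: "proj N2 = ray 0"
  using lucas_recurrence[of "- 1"] by (simp_all add: ray_def lucas_values)

section \<open>Gluing and monodromy act by shifting rays\<close>

lemma matrix_inv_left: "invertible A \<Longrightarrow> matrix_inv A ** A = mat 1"
  and matrix_inv_right: "invertible A \<Longrightarrow> A ** matrix_inv A = mat 1"
  for A :: "real^'n^'n"
  unfolding invertible_def matrix_inv_def by (drule someI_ex, simp)+

lemma matrix_inv_vector_eq:
  fixes A :: "real^'n^'n"
  assumes "invertible A" "A *v x = y"
  shows "matrix_inv A *v y = x"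
  using assms by (metis matrix_inv_left matrix_vector_mul_assoc matrix_vector_mul_lid)

lemma proj_N1'_N2': "proj N1' = ray 1" "proj N2' = ray 0"
proof -
  note conj = proj_conjugate[OF _ matrix_inv_left[OF invertible_phi(1)], of _ _ _ 1 0 "- 4" "- 1"]
  have "proj N1' = - proj N1 + 4 *\<^sub>R proj N2"
    using conj[of N1 1 0] by (simp add: N1'_def phi21_basis)
  then show "proj N1' = ray 1"
    using lucas_recurrence[of 0] by (simp add: ray_def lucas_values)
  have "proj N2' = proj N2"
    using conj[of N2 0 1] by (simp add: N2'_def phi21_basis)
  then show "proj N2' = ray 0" by (simp add: proj_N2)
qed

lemma phi31_basis: "phi31 *v e 1 = - e 1" "phi31 *v e 2 = - e 2 - 4 *\<^sub>R e 3" "phi31 *v e 3 = e 3"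
  unfolding phi31_def
  by (rule matrix_inv_vector_eq[OF invertible_phi(3)],
      simp add: phi13_basis matrix_vector_uminus matrix_vector_mult_diff_distrib matrix_vector_mult_scaleR)+

lemma invertible_matrix_inv: "invertible A \<Longrightarrow> invertible (matrix_inv A)"
  for A :: "real^'n^'n"
  unfolding invertible_def[of "matrix_inv A"] using matrix_inv_left matrix_inv_right by blast

lemma proj_N1''_N2'': "proj N1'' = ray (- 1)" "proj N2'' = ray (- 2)"
proof -
  have "invertible phi31"
    by (simp add: phi31_def invertible_matrix_inv invertible_phi)
  note conj = proj_conjugate[OF _ matrix_inv_left[OF this], of _ _ _ "- 1" "- 4" 0 1]
  have "proj N1'' = proj N1"
    using conj[of N1 1 0] by (simp add: N1''_def phi31_basis)
  then show "proj N1'' = ray (- 1)" by (simp add: proj_N1)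
  have "proj N2'' = 4 *\<^sub>R proj N1 - proj N2"
    using conj[of N2 0 1] by (simp add: N2''_def phi31_basis)
  then show "proj N2'' = ray (- 2)"
    using lucas_recurrence[of "- 1"] lucas_recurrence[of "- 2"] by (simp add: ray_def lucas_values)
qed

lemma invertible_rho: "invertible rho"
  by (simp add: rho_def invertible_mult invertible_phi)

lemma rho_basis: "rho *v e 1 = - e 1" "rho *v e 2 = 4 *\<^sub>R e 2 + 15 *\<^sub>R e 3"
  "rho *v e 3 = - 15 *\<^sub>R e 2 - 56 *\<^sub>R e 3"
  by (simp_all add: rho_def matrix_vector_mul_assoc[symmetric] phi21_basis phi32_basis phi13_basis
      matrix_vector_uminus matrix_vector_mult_diff_distrib matrix_vector_mult_scaleR algebra_simps)
     (simp_all add: vec_eq_iff)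

lemma rho_inverse_basis: "matrix_inv rho *v e 1 = - e 1"
  "matrix_inv rho *v e 2 = - 56 *\<^sub>R e 2 - 15 *\<^sub>R e 3"
  "matrix_inv rho *v e 3 = 15 *\<^sub>R e 2 + 4 *\<^sub>R e 3"
  by (rule matrix_inv_vector_eq[OF invertible_rho],
      simp add: rho_basis matrix_vector_uminus matrix_vector_right_distrib
        matrix_vector_mult_diff_distrib matrix_vector_mult_scaleR vec_eq_iff)+

text \<open>
  Three steps of the recurrence have the coefficients that occur in the block of \<open>rho\<close>; this is why
  conjugation by \<open>rho\<close> moves every ray by three places.
\<close>

lemma lucas_shift3:
  "lucas (k + 3) = 15 * lucas (k + 1) - 4 * lucas k"
  "lucas (k + 4) = 56 * lucas (k + 1) - 15 * lucas k"
proof -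
  have shift: "k + 1 + 1 = k + 2" "k + 1 + 2 = k + 3" "k + 2 + 1 = k + 3" "k + 2 + 2 = k + 4" by simp_all
  show "lucas (k + 3) = 15 * lucas (k + 1) - 4 * lucas k"
    "lucas (k + 4) = 56 * lucas (k + 1) - 15 * lucas k"
    using lucas_recurrence[of k] lucas_recurrence[of "k + 1"] lucas_recurrence[of "k + 2"]
    unfolding shift by simp_all
qed

lemma proj_conjugate_rho:
  assumes "proj X = ray k"
  shows "proj (matrix_inv rho ** X ** rho) = ray (k + 3)"
proof -
  have "proj (matrix_inv rho ** X ** rho)
      = - (4 * (- lucas k) + 15 * lucas (k + 1)) *\<^sub>R proj N1
        - (- 15 * (- lucas k) + - 56 * lucas (k + 1)) *\<^sub>R proj N2"
    using assms
    by (intro proj_conjugate[OF _ matrix_inv_left[OF invertible_rho]]) (simp_all add: ray_def rho_basis)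
  also have "\<dots> = ray (k + 3)"
    by (simp add: ray_def lucas_shift3 add.assoc algebra_simps)
  finally show ?thesis .
qed

lemma proj_conjugate_rho_inverse:
  assumes "proj X = ray k"
  shows "proj (rho ** X ** matrix_inv rho) = ray (k - 3)"
proof -
  have "proj (rho ** X ** matrix_inv rho)
      = - (- 56 * (- lucas k) + - 15 * lucas (k + 1)) *\<^sub>R proj N1
        - (15 * (- lucas k) + 4 * lucas (k + 1)) *\<^sub>R proj N2"
    using assms
    by (intro proj_conjugate[OF _ matrix_inv_right[OF invertible_rho]])
       (simp_all add: ray_def rho_inverse_basis)
  also have "\<dots> = ray (k - 3)"
  proof -
    have "lucas k = 15 * lucas (k - 2) - 4 * lucas (k - 3)"
      "lucas (k + 1) = 56 * lucas (k - 2) - 15 * lucas (k - 3)"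
      using lucas_shift3[of "k - 3"] by (simp_all add: add.commute)
    then have "- (- 56 * (- lucas k) + - 15 * lucas (k + 1)) = - lucas (k - 3)"
      "15 * (- lucas k) + 4 * lucas (k + 1) = - lucas (k - 2)" by simp_all
    then show ?thesis by (simp only: ray_def) simp
  qed
  finally show ?thesis .
qed

lemma mat_pow_Suc_right: "mat_pow A (Suc k) = mat_pow A k ** A"
  by (induction k) (simp_all add: mat_pow_def matrix_mul_assoc)

text \<open>
  The shift \<open>d\<close> is left general because negative powers of \<open>rho\<close> are powers of its inverse, for which
  the roles of \<open>h\<close> and \<open>g\<close> are exchanged and \<open>d\<close> changes sign.
\<close>

lemma proj_conjugate_mat_pow:
  assumes step: "\<And>X k. proj X = ray k \<Longrightarrow> proj (h ** X ** g) = ray (k + d)"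
    and "proj X = ray k"
  shows "proj (mat_pow h m ** X ** mat_pow g m) = ray (k + d * int m)"
proof (induction m)
  case 0
  then show ?case using assms(2) by (simp add: mat_pow_def)
next
  case (Suc m)
  have "mat_pow h (Suc m) ** X ** mat_pow g (Suc m) = h ** (mat_pow h m ** X ** mat_pow g m) ** g"
    by (simp only: mat_pow_Suc[of h] mat_pow_Suc_right[of g] matrix_mul_assoc)
  with step[OF Suc] show ?case by (simp add: algebra_simps)
qed

lemma proj_conjugate_rho_powi:
  assumes "proj X = ray k"
  shows "proj (mat_powi rho (- n) ** X ** mat_powi rho n) = ray (k + 3 * n)"
proof (cases "0 \<le> n")
  case True
  have "mat_powi rho (- n) = mat_pow (matrix_inv rho) (nat n)"
    using True by (cases "n = 0") (simp_all add: mat_powi_def mat_pow_def)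
  then show ?thesis
    using True proj_conjugate_mat_pow[OF proj_conjugate_rho assms, of "nat n"] by (simp add: mat_powi_def)
next
  case False
  have "proj (rho ** Y ** matrix_inv rho) = ray (j + - 3)" if "proj Y = ray j" for Y j
    using proj_conjugate_rho_inverse[OF that] by simp
  from proj_conjugate_mat_pow[OF this assms, of "nat (- n)"] show ?thesis
    using False by (simp add: mat_powi_def)
qed

lemma matrix_matrix_add_rdistrib: "(A + B) ** C = A ** C + B ** (C :: real^'n^'m)" for A :: "real^'m^'k"
  by (simp add: matrix_matrix_mult_def vec_eq_iff sum.distrib algebra_simps)

lemma conjugate_pos_cone:
  assumes "proj X = ray j" "proj Y = ray k"
  shows "proj ` (\<lambda>X. mat_powi rho (- n) ** X ** mat_powi rho n) ` pos_cone X Y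
    = pos_cone (ray (j + 3 * n)) (ray (k + 3 * n))"
proof -
  have "linear (\<lambda>X. proj (mat_powi rho (- n) ** X ** mat_powi rho n))"
  proof (rule linearI)
    fix X Y :: "real^6^6" and c :: real
    show "proj (mat_powi rho (- n) ** (X + Y) ** mat_powi rho n)
        = proj (mat_powi rho (- n) ** X ** mat_powi rho n) + proj (mat_powi rho (- n) ** Y ** mat_powi rho n)"
      by (simp add: matrix_add_ldistrib matrix_matrix_add_rdistrib linear_add[OF linear_proj])
    show "proj (mat_powi rho (- n) ** (c *\<^sub>R X) ** mat_powi rho n)
        = c *\<^sub>R proj (mat_powi rho (- n) ** X ** mat_powi rho n)"
      by (simp add: matrix_scalar_ac scalar_matrix_assoc[symmetric] linear_cmul[OF linear_proj])
  qed
  then show ?thesis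
    by (simp add: image_image pos_cone_image assms proj_conjugate_rho_powi)
qed

section \<open>The union of the closed cones\<close>

theorem corollary4p12:
  shows "(\<Union>n::int. closure (proj `
            ((\<lambda>X. mat_powi rho (- n) ** X ** mat_powi rho n) ` (Sigma2 \<union> Sigma1 \<union> Sigma3))))
       = insert 0 (pos_cone (- proj N1 + (2 + sqrt 3) *\<^sub>R proj N2)
                            (proj N1 - (2 - sqrt 3) *\<^sub>R proj N2))"
proof -
  define C where "C k = nonneg_cone (ray k) (ray (k + 1))" for k
  have "closure (proj ` (\<lambda>X. mat_powi rho (- n) ** X ** mat_powi rho n) ` (Sigma2 \<union> Sigma1 \<union> Sigma3))
      = C (3 * n) \<union> C (3 * n - 1) \<union> C (3 * n - 2)" for n
  proof -
    have "proj ` (\<lambda>X. mat_powi rho (- n) ** X ** mat_powi rho n) ` Sigma2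
        = pos_cone (ray (3 * n)) (ray (3 * n + 1))"
      using conjugate_pos_cone[OF proj_N1'_N2'(2) proj_N1'_N2'(1), of n]
      unfolding Sigma2_def pos_cone_commute[of N1' N2'] by (simp add: add.commute)
    moreover have "proj ` (\<lambda>X. mat_powi rho (- n) ** X ** mat_powi rho n) ` Sigma1
        = pos_cone (ray (3 * n - 1)) (ray (3 * n - 1 + 1))"
      using conjugate_pos_cone[OF proj_N1 proj_N2, of n] by (simp add: Sigma1_def)
    moreover have "proj ` (\<lambda>X. mat_powi rho (- n) ** X ** mat_powi rho n) ` Sigma3
        = pos_cone (ray (3 * n - 2)) (ray (3 * n - 2 + 1))"
      using conjugate_pos_cone[OF proj_N1''_N2''(2) proj_N1''_N2''(1), of n]
      by (simp add: Sigma3_def pos_cone_commute[of N1'' N2''])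
    ultimately show ?thesis
      by (simp only: image_Un closure_Un closure_pos_cone_ray C_def)
  qed
  moreover have "(\<Union>n. C (3 * n) \<union> C (3 * n - 1) \<union> C (3 * n - 2)) = (\<Union>k. C k)"
  proof -
    have "\<exists>n. C k \<subseteq> C (3 * n) \<union> C (3 * n - 1) \<union> C (3 * n - 2)" for k
    proof -
      have "\<exists>n. k = 3 * n \<or> k = 3 * n - 1 \<or> k = 3 * n - 2"
        by presburger
      then show ?thesis by (metis Un_upper1 Un_upper2 Un_assoc le_supI1)
    qed
    then have "(\<Union>k. C k) \<subseteq> (\<Union>n. C (3 * n) \<union> C (3 * n - 1) \<union> C (3 * n - 2))"
      by (intro UN_least) (meson UNIV_I UN_upper order_trans)
    moreover have "(\<Union>n. C (3 * n) \<union> C (3 * n - 1) \<union> C (3 * n - 2)) \<subseteq> (\<Union>k. C k)"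
      by (intro UN_least Un_least UN_upper UNIV_I)
    ultimately show ?thesis by (rule equalityI[rotated])
  qed
  ultimately show ?thesis
    using union_nonneg_cone_ray unfolding C_def by (simp only:)
qed

end
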